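(* Let $n,d\ge1$ be integers, let $\mathcal{T}\in\mathbb{C}^{n^{2d}}$ be a CPS tensor, and let $\pi=(\pi_1,\dots,\pi_{2d})$ be a permutation of $\{1,\dots,2d\}$ satisfying $$\left|\{\pi_k,\pi_{d+k}\}\cap\{1,\dots,d\}\right|=1\quad\text{for all }k=1,\dots,d.$$ Then $M_\pi(\mathcal{T})$ is a Hermitian matrix.
   Context: $\mathbb{C}^{n^{2d}}$ denotes the space of complex tensors of order $2d$ with every mode of dimension $n$. $\mathcal{T}\in\mathbb{C}^{n^{2d}}$ is partial-symmetric (PS) if its entries are invariant under any permutation of the first $d$ indices and under any permutation of the last $d$ indices. It is conjugate partial-symmetric (CPS) if it is PS and $\mathcal{T}_{i_1\dots i_d i_{d+1}\dots i_{2d}}=\overline{\mathcal{T}_{i_{d+1}\dots i_{2d}i_1\dots i_d}}$ for all indices. For $1\le i_1,\dots,i_d\le n$ put $n(i_1\dots i_d):=\sum_{k=1}^d(i_k-1)n^{d-k}+1\in\{1,\dots,n^d\}$. For a permutation $\pi$ of $\{1,\dots,2d\}$, the $\pi$-matricization $M_\pi(\mathcal{T})$ is the $n^d\times n^d$ matrix defined by $$M_\pi(\mathcal{T})_{n(i_{\pi_1}\dots i_{\pi_d})\,n(i_{\pi_{d+1}}\dots i_{\pi_{2d}})}=\mathcal{T}_{i_1\dots i_{2d}}\quad\text{for all }1\le i_1,\dots,i_{2d}\le n.$$ *)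

theory Defs
  imports
    "HOL-Library.FuncSet"
    "HOL-Combinatorics.Permutations"
    "Jordan_Normal_Form.Schur_Decomposition"
begin

text \<open>A multi-index \<open>(i\<^sub>1, \<dots>, i\<^sub>m)\<close> with entries in \<open>{1..n}\<close> is an extensional function on \<open>{1..m}\<close>,
  so that permuting its positions by \<open>\<sigma>\<close> is composition: \<open>(i \<circ> \<sigma>) k = i\<^bsub>\<sigma> k\<^esub>\<close>. Permutations of \<open>{1..m}\<close>
  fix everything outside that set, hence \<open>i \<circ> \<sigma>\<close> is again a multi-index.\<close>

definition multi_index :: "nat \<Rightarrow> nat \<Rightarrow> (nat \<Rightarrow> nat) set" where
  "multi_index m n = {1..m} \<rightarrow>\<^sub>E {1..n}"

type_synonym tensor = "(nat \<Rightarrow> nat) \<Rightarrow> complex"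

definition tensor_space :: "nat \<Rightarrow> nat \<Rightarrow> tensor set" where
  "tensor_space m n = multi_index m n \<rightarrow>\<^sub>E UNIV"

definition partial_symmetric :: "nat \<Rightarrow> nat \<Rightarrow> tensor \<Rightarrow> bool" where
  "partial_symmetric d n T \<longleftrightarrow>
     (\<forall>i \<in> multi_index (2 * d) n.
        (\<forall>\<sigma>. \<sigma> permutes {1..d} \<longrightarrow> T (i \<circ> \<sigma>) = T i) \<and>
        (\<forall>\<sigma>. \<sigma> permutes {d+1..2*d} \<longrightarrow> T (i \<circ> \<sigma>) = T i))"

definition half_swap :: "nat \<Rightarrow> nat \<Rightarrow> nat" where
  "half_swap d k = (if k \<in> {1..d} then d + k else if k \<in> {d+1..2*d} then k - d else k)"

definition conj_partial_symmetric :: "nat \<Rightarrow> nat \<Rightarrow> tensor \<Rightarrow> bool" where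
  "conj_partial_symmetric d n T \<longleftrightarrow>
     partial_symmetric d n T \<and>
     (\<forall>i \<in> multi_index (2 * d) n. T i = cnj (T (i \<circ> half_swap d)))"

definition position :: "nat \<Rightarrow> nat \<Rightarrow> (nat \<Rightarrow> nat) \<Rightarrow> nat" where
  "position d n i = (\<Sum>k=1..d. (i k - 1) * n ^ (d - k)) + 1"

text \<open>Rows and columns of \<open>mat\<close> are numbered from 0, whereas \<open>position\<close> takes values in \<open>{1..n ^ d}\<close>.
  The multi-index selected below exists and is unique; the resulting defining equation
  of the matricization is \<open>matricization_index\<close> below.\<close>

definition matricization :: "nat \<Rightarrow> nat \<Rightarrow> (nat \<Rightarrow> nat) \<Rightarrow> tensor \<Rightarrow> complex mat" where
  "matricization d n \<pi> T = mat (n ^ d) (n ^ d) (\<lambda>(r, c).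
     T (THE i. i \<in> multi_index (2 * d) n \<and>
               position d n (\<lambda>k. i (\<pi> k)) = r + 1 \<and>
               position d n (\<lambda>k. i (\<pi> (d + k))) = c + 1))"

definition hermitian_mat :: "complex mat \<Rightarrow> bool" where
  "hermitian_mat A \<longleftrightarrow> mat_adjoint A = A"

lemma position_Suc:
  "position (Suc d) n i = n * (position d n i - 1) + (i (Suc d) - 1) + 1"
proof -
  have "(\<Sum>k=1..d. (i k - 1) * n ^ (Suc d - k)) = n * (\<Sum>k=1..d. (i k - 1) * n ^ (d - k))"
    by (auto simp: sum_distrib_left Suc_diff_le intro!: sum.cong)
  then show ?thesis by (simp add: position_def)
qed

lemma position_le:
  assumes "\<And>k. k \<in> {1..d} \<Longrightarrow> i k \<in> {1..n}"
  shows "position d n i \<le> n ^ d"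
  using assms
proof (induction d)
  case 0
  then show ?case by (simp add: position_def)
next
  case (Suc d)
  obtain p where p: "position d n i = Suc p" by (simp add: position_def)
  have "Suc p \<le> n ^ d" using Suc p by auto
  then have "n * Suc p \<le> n ^ Suc d" by (metis mult_le_mono2 power_Suc)
  moreover have "i (Suc d) \<in> {1..n}" using Suc.prems by auto
  ultimately show ?case by (simp add: position_Suc p)
qed

lemma position_inject:
  assumes "\<And>k. k \<in> {1..d} \<Longrightarrow> i k \<in> {1..n}" "\<And>k. k \<in> {1..d} \<Longrightarrow> j k \<in> {1..n}"
    and "position d n i = position d n j" "k \<in> {1..d}"
  shows "i k = j k"
  using assms
proof (induction d)
  case 0
  then show ?case by simp
next
  case (Suc d)
  let ?a = "i (Suc d) - 1" and ?b = "j (Suc d) - 1"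
  have i: "i (Suc d) \<in> {1..n}" and j: "j (Suc d) \<in> {1..n}" using Suc.prems by auto
  then have lt: "?a < n" "?b < n" by auto
  have eq: "n * (position d n i - 1) + ?a = n * (position d n j - 1) + ?b"
    using Suc.prems(3) by (simp add: position_Suc)
  from arg_cong[OF eq, of "\<lambda>x. x mod n"] lt have ab: "?a = ?b" by simp
  with eq lt have "position d n i - 1 = position d n j - 1" by auto
  then have p: "position d n i = position d n j" by (simp add: position_def)
  show ?case
  proof (cases "k = Suc d")
    case True
    then show ?thesis using ab i j by auto
  next
    case False
    then show ?thesis using Suc.IH Suc.prems p by auto
  qed
qed

lemma matricization_carrier: "matricization d n \<pi> T \<in> carrier_mat (n ^ d) (n ^ d)"
  by (simp add: matricization_def)

lemma matricization_index:
  assumes \<pi>: "\<pi> permutes {1..2*d}" and i: "i \<in> multi_index (2 * d) n"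
  shows "matricization d n \<pi> T $$ (position d n (\<lambda>k. i (\<pi> k)) - 1,
           position d n (\<lambda>k. i (\<pi> (d + k))) - 1) = T i"
proof -
  let ?r = "\<lambda>i. position d n (\<lambda>k. i (\<pi> k))" and ?c = "\<lambda>i. position d n (\<lambda>k. i (\<pi> (d + k)))"
  have rng: "j (\<pi> k) \<in> {1..n}" if "j \<in> multi_index (2 * d) n" "k \<in> {1..2*d}" for j k
    using that permutes_in_image[OF \<pi>] by (auto simp: multi_index_def PiE_iff)
  have pos: "1 \<le> ?r j" "1 \<le> ?c j" for j by (auto simp: position_def)
  have le: "?r i \<le> n ^ d" "?c i \<le> n ^ d" by (auto intro!: position_le rng[OF i, simplified])
  have "j = i" if j: "j \<in> multi_index (2 * d) n" and r: "?r j = ?r i" and c: "?c j = ?c i" for j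
  proof (rule PiE_ext[OF j[unfolded multi_index_def] i[unfolded multi_index_def]])
    fix l assume "l \<in> {1..2*d}"
    then obtain k where k: "k \<in> {1..2*d}" and l: "l = \<pi> k"
      using permutes_image[OF \<pi>] by blast
    show "j l = i l"
    proof (cases "k \<le> d")
      case True
      then show ?thesis
        using position_inject[OF _ _ r, of k] rng[OF i] rng[OF j] k l by auto
    next
      case False
      then have kd: "k - d \<in> {1..d}" "d + (k - d) = k" using k by auto
      show ?thesis
        using position_inject[OF _ _ c kd(1)] rng[OF i] rng[OF j] kd(2) l by auto
    qed
  qed
  then have "(THE j. j \<in> multi_index (2 * d) n \<and> ?r j = ?r i \<and> ?c j = ?c i) = i"
    using i by (intro the_equality) auto
  then show ?thesis
    using pos[of i] le by (simp add: matricization_def)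
qed

end

theory Submission
  imports Defs
begin

text \<open>Interchanging the row and the column of the entry \<open>T i\<close> of the matricization replaces \<open>i\<close> by
  \<open>i \<circ> \<tau>\<close>, where the involution \<open>\<tau>\<close> exchanges \<open>\<pi> k\<close> with \<open>\<pi> (d + k)\<close>. The condition on \<open>\<pi>\<close> says that
  \<open>\<tau>\<close> exchanges \<open>{1..d}\<close> and \<open>{d+1..2*d}\<close>. Thus \<open>\<tau>\<close> is the half swap followed by permutations inside
  the two halves, and conjugate partial symmetry gives \<open>T (i \<circ> \<tau>) = cnj (T i)\<close>.\<close>

lemma position_cong:
  "(\<And>k. k \<in> {1..d} \<Longrightarrow> i k = j k) \<Longrightarrow> position d n i = position d n j"
  by (simp add: position_def)

text \<open>The indices are the base-\<open>n\<close> digits of \<open>r\<close>, each shifted by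
  one, the most significant first. The induction splits off the last digit: \<open>r div n\<close>
  supplies the first \<open>d\<close> indices and \<open>r mod n\<close> the remaining one.\<close>

lemma position_surj:
  assumes "r < n ^ d"
  shows "\<exists>i. (\<forall>k\<in>{1..d}. i k \<in> {1..n}) \<and> position d n i = r + 1"
  using assms
proof (induction d arbitrary: r)
  case 0
  then show ?case by (simp add: position_def)
next
  case (Suc d)
  from Suc.prems have n: "n > 0" by (cases n) auto
  have "r div n < n ^ d"
    using Suc.prems by (simp add: less_mult_imp_div_less mult.commute)
  then obtain i where i: "\<forall>k\<in>{1..d}. i k \<in> {1..n}" "position d n i = r div n + 1"
    using Suc.IH by blast
  let ?j = "i(Suc d := r mod n + 1)"
  have "position d n ?j = position d n i" by (rule position_cong) auto
  then have "position (Suc d) n ?j = r + 1" by (simp add: position_Suc i)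
  moreover have "\<forall>k\<in>{1..Suc d}. ?j k \<in> {1..n}"
    using i(1) n by (auto simp: Suc_le_eq)
  ultimately show ?case by blast
qed

lemma multi_index_comp:
  assumes "i \<in> multi_index m n" "\<sigma> permutes {1..m}"
  shows "i \<circ> \<sigma> \<in> multi_index m n"
  unfolding multi_index_def
proof (rule PiE_I)
  fix k assume "k \<in> {1..m}"
  then have "\<sigma> k \<in> {1..m}" using permutes_in_image[OF assms(2)] by blast
  then show "(i \<circ> \<sigma>) k \<in> {1..n}" using assms(1) by (auto simp: multi_index_def)
next
  fix k assume "k \<notin> {1..m}"
  then have "\<sigma> k = k" using permutes_not_in[OF assms(2)] by blast
  then show "(i \<circ> \<sigma>) k = undefined"
    using PiE_arb[OF assms(1)[unfolded multi_index_def] \<open>k \<notin> {1..m}\<close>] by simp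
qed

text \<open>\<open>matricization_index\<close> only evaluates entries whose row and column come from
  a multi-index. This lemma shows that every entry of the matrix is of that kind, so a claim about
  all entries can be checked on multi-indices.\<close>

lemma multi_index_position_surj:
  assumes \<pi>: "\<pi> permutes {1..2*d}" and "r < n ^ d" "c < n ^ d"
  obtains i where "i \<in> multi_index (2 * d) n"
    "position d n (\<lambda>k. i (\<pi> k)) = r + 1" "position d n (\<lambda>k. i (\<pi> (d + k))) = c + 1"
proof -
  obtain a where a: "\<forall>k\<in>{1..d}. a k \<in> {1..n}" "position d n a = r + 1"
    using position_surj assms by blast
  obtain b where b: "\<forall>k\<in>{1..d}. b k \<in> {1..n}" "position d n b = c + 1"
    using position_surj assms by blast
  \<comment> \<open>\<open>j\<close> lists the row indices and then the column indices; composing it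
    with the inverse of \<open>\<pi>\<close> moves each of them to its position in the tensor. The
    value \<open>undefined\<close> makes \<open>j\<close> extensional.\<close>
  define j where
    "j k = (if k \<in> {1..d} then a k else if k \<in> {d+1..2*d} then b (k - d) else undefined)" for k
  have "j \<in> multi_index (2 * d) n"
    unfolding multi_index_def
  proof (rule PiE_I)
    fix k assume "k \<in> {1..2*d}"
    then have "k \<in> {1..d} \<or> k \<in> {d+1..2*d} \<and> k \<notin> {1..d} \<and> k - d \<in> {1..d}" by auto
    then show "j k \<in> {1..n}" using a(1) b(1) unfolding j_def by (metis (no_types, lifting))
  qed (auto simp: j_def)
  then have "j \<circ> inv_into UNIV \<pi> \<in> multi_index (2 * d) n"
    using multi_index_comp permutes_inv[OF \<pi>] by blast
  moreover have inverse: "(j \<circ> inv_into UNIV \<pi>) (\<pi> k) = j k" for k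
    using permutes_inverses[OF \<pi>] by simp
  have "position d n (\<lambda>k. (j \<circ> inv_into UNIV \<pi>) (\<pi> k)) = r + 1"
    unfolding inverse a(2)[symmetric] by (rule position_cong) (simp add: j_def)
  moreover have "position d n (\<lambda>k. (j \<circ> inv_into UNIV \<pi>) (\<pi> (d + k))) = c + 1"
    unfolding inverse b(2)[symmetric] by (rule position_cong) (auto simp: j_def)
  ultimately show thesis by (rule that)
qed

text \<open>An injective map of a finite set into itself is onto, so the inclusion already makes
  \<open>p\<close> a bijection of \<open>A\<close>.\<close>

lemma permutes_restrict_invariant:
  assumes "p permutes S" "finite A" "p ` A \<subseteq> A"
  shows "(\<lambda>x. if x \<in> A then p x else x) permutes A"
proof (rule bij_imp_permutes)
  have inj: "inj_on p A" using permutes_inj_on[OF assms(1)] .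
  then have "p ` A = A" using assms(2,3) by (simp add: endo_inj_surj)
  then have "bij_betw p A A" using inj by (simp add: bij_betw_def)
  then show "bij_betw (\<lambda>x. if x \<in> A then p x else x) A A"
    by (rule bij_betw_cong[THEN iffD1, rotated]) simp
qed auto

text \<open>Since \<open>\<rho>\<close> preserves both halves, it is the product of its restrictions
  to them, and partial symmetry removes these one at a time.\<close>

lemma partial_symmetric_comp:
  assumes T: "partial_symmetric d n T" and i: "i \<in> multi_index (2 * d) n"
    and \<rho>: "\<rho> permutes {1..2*d}" "\<rho> ` {1..d} \<subseteq> {1..d}" "\<rho> ` {d+1..2*d} \<subseteq> {d+1..2*d}"
  shows "T (i \<circ> \<rho>) = T i"
proof -
  define \<sigma> where "\<sigma> = (\<lambda>k. if k \<in> {1..d} then \<rho> k else k)"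
  define \<sigma>' where "\<sigma>' = (\<lambda>k. if k \<in> {d+1..2*d} then \<rho> k else k)"
  have \<sigma>: "\<sigma> permutes {1..d}" and \<sigma>': "\<sigma>' permutes {d+1..2*d}"
    unfolding \<sigma>_def \<sigma>'_def using \<rho> by (simp_all only: permutes_restrict_invariant finite_atLeastAtMost)
  have "\<rho> k = (\<sigma> \<circ> \<sigma>') k" for k
  proof -
    consider "k \<in> {1..d}" | "k \<in> {d+1..2*d}" | "k \<notin> {1..2*d}" by fastforce
    then show ?thesis
    proof cases
      case 1
      then show ?thesis by (auto simp: \<sigma>_def \<sigma>'_def)
    next
      case 2
      then have "\<rho> k \<in> {d+1..2*d}" using \<rho>(3) by blast
      with 2 show ?thesis by (auto simp: \<sigma>_def \<sigma>'_def)
    next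
      case 3
      then have "\<rho> k = k" using permutes_not_in[OF \<rho>(1)] by blast
      with 3 show ?thesis by (auto simp: \<sigma>_def \<sigma>'_def)
    qed
  qed
  then have "i \<circ> \<rho> = (i \<circ> \<sigma>) \<circ> \<sigma>'" by auto
  \<comment> \<open>Removing \<open>\<sigma>'\<close> first applies partial symmetry at
    \<open>i \<circ> \<sigma>\<close>, which must therefore be a multi-index itself.\<close>
  moreover have "i \<circ> \<sigma> \<in> multi_index (2 * d) n"
    using multi_index_comp[OF i] permutes_subset[OF \<sigma>, of "{1..2*d}"] by auto
  ultimately show ?thesis using T i \<sigma> \<sigma>' by (simp add: partial_symmetric_def)
qed

lemma half_swap_half_swap [simp]: "half_swap d (half_swap d k) = k"
  by (auto simp: half_swap_def)

lemma half_swap_permutes: "half_swap d permutes {1..2*d}"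
proof (rule bij_imp_permutes)
  show "bij_betw (half_swap d) {1..2*d} {1..2*d}"
    by (rule bij_betw_byWitness[where f' = "half_swap d"]) (auto simp: half_swap_def)
qed (auto simp: half_swap_def)

lemma conj_partial_symmetric_comp_exchange:
  assumes T: "conj_partial_symmetric d n T" and i: "i \<in> multi_index (2 * d) n"
    and \<tau>: "\<tau> permutes {1..2*d}" "\<tau> ` {1..d} \<subseteq> {d+1..2*d}" "\<tau> ` {d+1..2*d} \<subseteq> {1..d}"
  shows "T (i \<circ> \<tau>) = cnj (T i)"
proof -
  let ?s = "half_swap d"
  have ps: "partial_symmetric d n T" and cnj: "T i = cnj (T (i \<circ> ?s))"
    using T i by (auto simp: conj_partial_symmetric_def)
  have s: "?s ` {1..d} \<subseteq> {d+1..2*d}" "?s ` {d+1..2*d} \<subseteq> {1..d}"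
    by (auto simp: half_swap_def)
  \<comment> \<open>The half swap is an involution, so it may be inserted twice. Both
    \<open>?s\<close> and \<open>\<tau>\<close> exchange the halves, hence
    \<open>?s \<circ> \<tau>\<close> preserves each of them.\<close>
  have "i \<circ> \<tau> = (i \<circ> ?s) \<circ> (?s \<circ> \<tau>)" by auto
  moreover have "T ((i \<circ> ?s) \<circ> (?s \<circ> \<tau>)) = T (i \<circ> ?s)"
  proof (rule partial_symmetric_comp[OF ps])
    show "i \<circ> ?s \<in> multi_index (2 * d) n" by (rule multi_index_comp[OF i half_swap_permutes])
    show "?s \<circ> \<tau> permutes {1..2*d}" by (rule permutes_compose[OF \<tau>(1) half_swap_permutes])
    show "(?s \<circ> \<tau>) ` {1..d} \<subseteq> {1..d}" "(?s \<circ> \<tau>) ` {d+1..2*d} \<subseteq> {d+1..2*d}"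
      unfolding image_comp[symmetric] using \<tau>(2,3) s by blast+
  qed
  ultimately show ?thesis using cnj by simp
qed

text \<open>Distinctness matters: for \<open>x = y\<close> in \<open>A\<close> the intersection
  would also have one element.\<close>

lemma card_pair_Int_eq_1D:
  assumes "card ({x, y} \<inter> A) = 1" "x \<noteq> y"
  shows "x \<in> A \<longleftrightarrow> y \<notin> A"
proof -
  have "{x, y} \<inter> A = (if x \<in> A then {x} else {}) \<union> (if y \<in> A then {y} else {})" by auto
  with assms show ?thesis by (auto split: if_splits)
qed

lemma hermitian_matI:
  assumes A: "A \<in> carrier_mat m m"
    and "\<And>r c. r < m \<Longrightarrow> c < m \<Longrightarrow> A $$ (c, r) = cnj (A $$ (r, c))"
  shows "hermitian_mat A"
  unfolding hermitian_mat_def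
proof (rule eq_matI)
  fix r c assume rc: "r < dim_row A" "c < dim_col A"
  then have "mat_adjoint A $$ (r, c) = cnj (A $$ (c, r))"
    using A by (simp add: mat_adjoint_def mat_of_rows_def)
  also have "\<dots> = A $$ (r, c)" using assms(2)[of c r] rc A by simp
  finally show "mat_adjoint A $$ (r, c) = A $$ (r, c)" .
qed (use A in \<open>auto simp: mat_adjoint_def\<close>)

theorem proposition4p11:
  fixes n d :: nat and T :: tensor and \<pi> :: "nat \<Rightarrow> nat"
  assumes "n \<ge> 1" and "d \<ge> 1"
    and "T \<in> tensor_space (2 * d) n"
    and "conj_partial_symmetric d n T"
    and "\<pi> permutes {1..2*d}"
    and "\<forall>k \<in> {1..d}. card ({\<pi> k, \<pi> (d + k)} \<inter> {1..d}) = 1"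
  shows "hermitian_mat (matricization d n \<pi> T)"
proof (rule hermitian_matI[OF matricization_carrier])
  fix r c assume "r < n ^ d" "c < n ^ d"
  note \<pi> = \<open>\<pi> permutes {1..2*d}\<close>
  let ?s = "half_swap d"
  obtain i where i: "i \<in> multi_index (2 * d) n"
    and row: "position d n (\<lambda>k. i (\<pi> k)) = r + 1"
    and col: "position d n (\<lambda>k. i (\<pi> (d + k))) = c + 1"
    using multi_index_position_surj[OF \<pi> \<open>r < n ^ d\<close> \<open>c < n ^ d\<close>] .
  \<comment> \<open>Conjugating the half swap by \<open>\<pi>\<close> turns the exchange of the
    \<open>k\<close>-th row slot with the \<open>k\<close>-th column slot into an exchange of tensor
    positions.\<close>
  define \<tau> where "\<tau> = \<pi> \<circ> (?s \<circ> inv_into UNIV \<pi>)"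
  have \<tau>_\<pi>: "\<tau> (\<pi> k) = \<pi> (?s k)" for k
    using permutes_inverses[OF \<pi>] by (simp add: \<tau>_def)
  have \<tau>: "\<tau> permutes {1..2*d}"
    unfolding \<tau>_def by (intro permutes_compose[OF _ \<pi>] permutes_compose[OF _ half_swap_permutes]
        permutes_inv[OF \<pi>])
  have exchange: "\<pi> k \<in> {1..d} \<longleftrightarrow> \<pi> (d + k) \<notin> {1..d}" if "k \<in> {1..d}" for k
  proof (rule card_pair_Int_eq_1D)
    show "card ({\<pi> k, \<pi> (d + k)} \<inter> {1..d}) = 1" using assms(6) that by blast
    show "\<pi> k \<noteq> \<pi> (d + k)" using that by (simp add: inj_eq[OF permutes_inj[OF \<pi>]])
  qed
  \<comment> \<open>Every position belongs to a pair \<open>\<pi> k\<close>,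
    \<open>\<pi> (d + k)\<close> with \<open>k\<close> in \<open>{1..d}\<close>.
    \<open>\<tau>\<close> swaps the two members, and exactly one of them lies in the first
    half.\<close>
  have \<tau>_mem: "\<tau> l \<in> {1..d} \<longleftrightarrow> l \<notin> {1..d}" if l: "l \<in> {1..2*d}" for l
  proof -
    obtain k where k: "k \<in> {1..2*d}" "l = \<pi> k" using permutes_image[OF \<pi>] l by blast
    show ?thesis
    proof (cases "k \<le> d")
      case True
      then show ?thesis using exchange[of k] k by (simp add: \<tau>_\<pi> half_swap_def)
    next
      case False
      then have "k - d \<in> {1..d}" "d + (k - d) = k" "half_swap d k = k - d"
        using k(1) by (auto simp: half_swap_def)
      then show ?thesis using exchange[of "k - d"] k(2) by (simp only: \<tau>_\<pi>)
    qed
  qed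
  have "T (i \<circ> \<tau>) = cnj (T i)"
  proof (rule conj_partial_symmetric_comp_exchange[OF assms(4) i \<tau>])
    have img: "\<tau> l \<in> {1..2*d}" if "l \<in> {1..2*d}" for l
      using permutes_in_image[OF \<tau>] that by blast
    show "\<tau> ` {1..d} \<subseteq> {d+1..2*d}"
      using img \<tau>_mem by fastforce
    show "\<tau> ` {d+1..2*d} \<subseteq> {1..d}"
      using \<tau>_mem by fastforce
  qed
  \<comment> \<open>The row slots of \<open>i \<circ> \<tau>\<close> carry the column indices of
    \<open>i\<close> and vice versa, so \<open>T (i \<circ> \<tau>)\<close> is the entry at
    \<open>(c, r)\<close>.\<close>
  moreover have "position d n (\<lambda>k. (i \<circ> \<tau>) (\<pi> k)) = c + 1"
    unfolding col[symmetric] by (rule position_cong) (simp add: \<tau>_\<pi> half_swap_def)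
  moreover have "position d n (\<lambda>k. (i \<circ> \<tau>) (\<pi> (d + k))) = r + 1"
    unfolding row[symmetric] by (rule position_cong) (auto simp: \<tau>_\<pi> half_swap_def)
  ultimately show
    "matricization d n \<pi> T $$ (c, r) = cnj (matricization d n \<pi> T $$ (r, c))"
    using matricization_index[OF \<pi> i, of T] row col
      matricization_index[OF \<pi> multi_index_comp[OF i \<tau>], of T] by simp
qed

end
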